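(* Let $p,q$ be positive integers, let $\hat{x}\in\mathbb{R}^q\setminus\{0\}$, and let $f:\mathbb{R}^q\to\mathbb{R}$ be a convex function that is differentiable at $\hat{x}$. Let $K\subseteq\mathbb{R}^q$ be a closed convex cone with smooth boundary (that is, smooth away from the origin), let $A$ be a real $p\times q$ matrix of full rank, and let $b\in\mathbb{R}^p$. Suppose that the intersection of the interior of $K$ with the set $\{x\in\mathbb{R}^q : Ax=b\}$ is nonempty. Then $\hat{x}$ is a solution of the conic optimization problem $$CO(f,A,b,K,p,q):\quad \min f(x)\quad\text{subject to } Ax=b,\ x\in K,$$ if and only if there exists $\hat{y}\in\mathbb{R}^p$ such that $(\hat{y},\hat{x})$ is a solution of the mixed complementarity problem $MiCP(G,H,K,p,q)$ with $G(y,x)=b-Ax$ and $H(y,x)=\nabla f(x)-A^{\top}y$, that is, explicitly, such that $$A\hat{x}=b,\qquad \hat{x}\in K,\qquad \nabla f(\hat{x})-A^{\top}\hat{y}\in K^*,\qquad \langle \hat{x},\nabla f(\hat{x})-A^{\top}\hat{y}\rangle=0.$$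
   Context: $\mathbb{R}^n$ carries the canonical scalar product $\langle x,y\rangle=x^{\top}y$, and $x\perp y$ means $\langle x,y\rangle=0$. A closed convex cone is a closed convex set that is invariant under multiplication by positive scalars. The dual of a cone $K\subseteq\mathbb{R}^q$ is $K^*=\{d\in\mathbb{R}^q : \langle v,d\rangle\ge 0\ \text{for all } v\in K\}$. The boundary of the cone $K$ being smooth is understood as: $\partial K\setminus\{0\}$ is a (possibly empty) smooth hypersurface of $\mathbb{R}^q$. A solution of $CO(f,A,b,K,p,q)$ is a global minimizer of $f$ over the feasible set, i.e. a point $\hat{x}\in K$ with $A\hat{x}=b$ and $f(\hat{x})\le f(x)$ for all $x\in K$ with $Ax=b$. Mixed complementarity problem: given mappings $G$ and $H$ from $\mathbb{R}^p\times\mathbb{R}^q$ into $\mathbb{R}^p$ and $\mathbb{R}^q$ respectively, and a closed convex cone $C\subseteq\mathbb{R}^q$, the problem $MiCP(G,H,C,p,q)$ is to find $(u,v)\in\mathbb{R}^p\times C$ such that $G(u,v)=0$, $H(u,v)\in C^*$ and $v\perp H(u,v)$. In the claim only the value of $H$ at $(\hat{y},\hat{x})$ is involved, so only $\nabla f(\hat{x})$ is needed. *)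

theory Defs
  imports "HOL-Analysis.Analysis"
begin

definition closed_convex_cone :: "'a::real_normed_vector set \<Rightarrow> bool" where
  "closed_convex_cone C \<longleftrightarrow>
     closed C \<and> convex C \<and> (\<forall>v\<in>C. \<forall>t>0. t *\<^sub>R v \<in> C)"

lemma closed_convex_cone_iff_cone:
  "closed_convex_cone C \<longleftrightarrow> closed C \<and> convex C \<and> cone C"
proof -
  have "cone C" if C: "closed C" "\<forall>v\<in>C. \<forall>t>0. t *\<^sub>R v \<in> C"
  proof -
    have "0 \<in> C" if v: "v \<in> C" for v
    proof (rule closed_sequentially[OF C(1)])
      show "inverse (real (Suc n)) *\<^sub>R v \<in> C" for n
        using C(2) v by simp
      have "(\<lambda>n. inverse (real (Suc n)) *\<^sub>R v) \<longlonglongrightarrow> 0 *\<^sub>R v"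
        by (intro tendsto_scaleR LIMSEQ_inverse_real_of_nat tendsto_const)
      then show "(\<lambda>n. inverse (real (Suc n)) *\<^sub>R v) \<longlonglongrightarrow> 0"
        by simp
    qed
    then show ?thesis
      unfolding cone_def using C(2) by (metis order_le_less scaleR_zero_left)
  qed
  then show ?thesis
    unfolding closed_convex_cone_def by (auto simp: cone_def)
qed

definition dual_cone :: "'a::real_inner set \<Rightarrow> 'a set" where
  "dual_cone C = {d. \<forall>v\<in>C. 0 \<le> v \<bullet> d}"

text \<open>The gradient is meaningful only where \<open>f\<close> is differentiable.\<close>

definition gradient :: "('a::euclidean_space \<Rightarrow> real) \<Rightarrow> 'a \<Rightarrow> 'a" where
  "gradient f x = (THE D. GDERIV f x :> D)"

lemma gradient_eqI:
  assumes "GDERIV f x :> D"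
  shows "gradient f x = D"
  unfolding gradient_def
proof (rule the_equality[of "\<lambda>D. GDERIV f x :> D", OF assms])
  fix E assume "GDERIV f x :> E"
  then have "(\<lambda>h. h \<bullet> E) = (\<lambda>h. h \<bullet> D)"
    using assms unfolding gderiv_def by (rule has_derivative_unique)
  then show "E = D"
    by (metis vector_eq_ldot)
qed

lemma gderiv_gradient:
  assumes "f differentiable (at x)"
  shows "GDERIV f x :> gradient f x"
proof -
  obtain f' where f': "(f has_derivative f') (at x)"
    using assms unfolding differentiable_def by blast
  then have "linear f'"
    by (rule has_derivative_linear)
  then have "f' = (\<lambda>h. h \<bullet> adjoint f' 1)"
    by (simp add: fun_eq_iff adjoint_works)
  with f' have "GDERIV f x :> adjoint f' 1"
    unfolding gderiv_def by metis
  then show ?thesis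
    using gradient_eqI by metis
qed

text \<open>
  \<open>Ck_on k f U\<close>, for open \<open>U\<close>: \<open>f\<close> is \<open>k\<close> times continuously differentiable on \<open>U\<close>.
  Only the values of \<open>f\<close> on \<open>U\<close> matter, since \<open>U\<close> is open.
\<close>

primrec Ck_on :: "nat \<Rightarrow> ('a::euclidean_space \<Rightarrow> real) \<Rightarrow> 'a set \<Rightarrow> bool" where
  "Ck_on 0 f U \<longleftrightarrow> continuous_on U f"
| "Ck_on (Suc k) f U \<longleftrightarrow>
     (\<forall>x\<in>U. f differentiable (at x)) \<and>
     (\<forall>i\<in>Basis. Ck_on k (\<lambda>x. frechet_derivative f (at x) i) U)"

definition smooth_on :: "('a::euclidean_space \<Rightarrow> real) \<Rightarrow> 'a set \<Rightarrow> bool" where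
  "smooth_on f U \<longleftrightarrow> (\<forall>k. Ck_on k f U)"

text \<open>
  An embedded submanifold of codimension one, possibly empty and not necessarily closed:
  locally the zero set of a smooth function with nonvanishing gradient.
\<close>

definition smooth_hypersurface :: "'a::euclidean_space set \<Rightarrow> bool" where
  "smooth_hypersurface S \<longleftrightarrow>
     (\<forall>z\<in>S. \<exists>U \<phi>. open U \<and> z \<in> U \<and> smooth_on \<phi> U \<and>
        (\<forall>x\<in>U. gradient \<phi> x \<noteq> 0) \<and> S \<inter> U = {x\<in>U. \<phi> x = 0})"

definition smooth_boundary_off_origin :: "'a::euclidean_space set \<Rightarrow> bool" where
  "smooth_boundary_off_origin K \<longleftrightarrow> smooth_hypersurface (frontier K - {0})"

definition CO_solution ::
  "(real^'q \<Rightarrow> real) \<Rightarrow> real^'q^'p \<Rightarrow> real^'p \<Rightarrow> (real^'q) set \<Rightarrow> real^'q \<Rightarrow> bool" where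
  "CO_solution f A b K x \<longleftrightarrow>
     x \<in> K \<and> A *v x = b \<and> (\<forall>z\<in>K. A *v z = b \<longrightarrow> f x \<le> f z)"

definition MiCP_solution ::
  "(real^'p \<Rightarrow> real^'q \<Rightarrow> real^'p) \<Rightarrow> (real^'p \<Rightarrow> real^'q \<Rightarrow> real^'q) \<Rightarrow>
   (real^'q) set \<Rightarrow> (real^'p) \<times> (real^'q) \<Rightarrow> bool" where
  "MiCP_solution G H C = (\<lambda>(u, v).
     v \<in> C \<and> G u v = 0 \<and> H u v \<in> dual_cone C \<and> orthogonal v (H u v))"

end

theory Submission
  imports Defs
begin

text \<open>
  The equivalence is the Karush--Kuhn--Tucker theorem for a convex objective on an affine slice of
  a convex cone, under Slater's condition that the slice meets the interior of the cone.

  For a convex objective, minimality of \<open>x\<close> on the slice is the variational inequality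
  \<open>0 \<le> g \<bullet> (z - x)\<close> for all feasible \<open>z\<close>, where \<open>g\<close> is the gradient at \<open>x\<close>
  (\<open>convex_minimizer_iff_variational\<close>). A multiplier \<open>y\<close> gives this inequality at once, since
  \<open>A\<^sup>T y\<close> is orthogonal to \<open>z - x\<close> and \<open>g - A\<^sup>T y\<close> is nonnegative on the cone and zero at \<open>x\<close>.

  Conversely (\<open>conic_multiplier_exists\<close>), the variational inequality says that the cone misses
  the half-slice of all \<open>x + d\<close> with \<open>A d = 0\<close> and \<open>g \<bullet> d < 0\<close>. If the half-slice is
  empty, then \<open>g\<close> is orthogonal to the kernel of \<open>A\<close> and thus equals some \<open>A\<^sup>T y\<close>.
  Otherwise a hyperplane with normal \<open>a\<close> separates it from the cone. The functional \<open>a\<close> is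
  bounded below on the cone, hence nonnegative there, and its bound on the half-slice is at most
  its value \<open>0\<close> at the apex. It vanishes at \<open>x\<close>, because \<open>x\<close> lies in the cone and in the
  closure of the half-slice, and so it is nonpositive on all \<open>d\<close> as above. On the
  kernel of \<open>A\<close> the functional \<open>a\<close> is therefore \<open>c g\<close> for a number \<open>c \<ge> 0\<close>, which means that \<open>a - c g\<close> is in the range of \<open>A\<^sup>T\<close>. Slater's
  condition excludes \<open>c = 0\<close>: in that case \<open>a\<close> would be constant on the slice, hence zero
  there, whereas a nonzero functional that is nonnegative on the cone is positive in its interior.
  Dividing by \<open>c\<close> yields the multiplier.
\<close>

section \<open>Convex minimization and variational inequalities\<close>

lemma GDERIV_along_segment:
  fixes f :: "'a::real_inner \<Rightarrow> real"
  assumes "GDERIV f x :> g"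
  shows "((\<lambda>t. f (x + t *\<^sub>R d)) has_real_derivative (g \<bullet> d)) (at 0)"
proof -
  have line: "((\<lambda>t. x + t *\<^sub>R d) has_derivative (\<lambda>t. t *\<^sub>R d)) (at (0::real))"
    by (auto intro!: derivative_eq_intros)
  have "(f has_derivative (\<lambda>h. h \<bullet> g)) (at (x + 0 *\<^sub>R d))"
    using assms by (simp add: gderiv_def)
  from has_derivative_compose[OF line this]
  show ?thesis
    by (simp add: has_field_derivative_def inner_commute[of g] mult_commute_abs)
qed

lemma convex_on_above_tangent_plane:
  fixes f :: "'a::real_inner \<Rightarrow> real"
  assumes "convex_on UNIV f" and "GDERIV f x :> g"
  shows "f x + g \<bullet> (z - x) \<le> f z"
proof -
  let ?h = "\<lambda>t. f (x + t *\<^sub>R (z - x))"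
  have convex: "convex_on UNIV ?h"
  proof (rule convex_onI)
    fix t r s :: real
    assume t: "0 < t" "t < 1"
    have "x + ((1 - t) *\<^sub>R r + t *\<^sub>R s) *\<^sub>R (z - x) =
        (1 - t) *\<^sub>R (x + r *\<^sub>R (z - x)) + t *\<^sub>R (x + s *\<^sub>R (z - x))"
      by (simp add: algebra_simps)
    then show "?h ((1 - t) *\<^sub>R r + t *\<^sub>R s) \<le> (1 - t) * ?h r + t * ?h s"
      using convex_onD[OF assms(1), of t "x + r *\<^sub>R (z - x)" "x + s *\<^sub>R (z - x)"] t by simp
  qed simp
  have "?h 1 - ?h 0 \<ge> (g \<bullet> (z - x)) * (1 - 0)"
    by (rule convex_on_imp_above_tangent[OF convex])
      (use GDERIV_along_segment[OF assms(2)] in auto)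
  then show ?thesis
    by simp
qed

text \<open>
  A negative derivative at \<open>x\<close> towards \<open>z\<close> would let a short step along the segment, which stays in
  \<open>S\<close>, decrease \<open>f\<close>.
\<close>

lemma minimizer_imp_variational:
  fixes f :: "'a::real_inner \<Rightarrow> real"
  assumes "convex S" and "GDERIV f x :> g"
    and "x \<in> S" and min: "\<And>z. z \<in> S \<Longrightarrow> f x \<le> f z" and "z \<in> S"
  shows "0 \<le> g \<bullet> (z - x)"
proof (rule ccontr)
  assume "\<not> 0 \<le> g \<bullet> (z - x)"
  then obtain \<epsilon> where "\<epsilon> > 0"
    and dec: "\<And>t. 0 < t \<Longrightarrow> t < \<epsilon> \<Longrightarrow> f (x + t *\<^sub>R (z - x)) < f x"
    using DERIV_neg_dec_right[OF GDERIV_along_segment[OF assms(2), of "z - x"]] by force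
  define t where "t = min 1 (\<epsilon> / 2)"
  have t: "0 < t" "t \<le> 1" "t < \<epsilon>"
    using \<open>\<epsilon> > 0\<close> by (auto simp: t_def)
  have "(1 - t) *\<^sub>R x + t *\<^sub>R z \<in> S"
    using convexD[OF assms(1) assms(3) assms(5), of "1 - t" t] t by simp
  moreover have "(1 - t) *\<^sub>R x + t *\<^sub>R z = x + t *\<^sub>R (z - x)"
    by (simp add: algebra_simps)
  ultimately show False
    using min dec[OF t(1,3)] by fastforce
qed

lemma convex_minimizer_iff_variational:
  fixes f :: "'a::real_inner \<Rightarrow> real"
  assumes "convex_on UNIV f" and "GDERIV f x :> g" and "convex S" and "x \<in> S"
  shows "(\<forall>z\<in>S. f x \<le> f z) \<longleftrightarrow> (\<forall>z\<in>S. 0 \<le> g \<bullet> (z - x))"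
proof
  assume "\<forall>z\<in>S. f x \<le> f z"
  then show "\<forall>z\<in>S. 0 \<le> g \<bullet> (z - x)"
    using minimizer_imp_variational[OF assms(3,2,4)] by blast
next
  assume "\<forall>z\<in>S. 0 \<le> g \<bullet> (z - x)"
  then show "\<forall>z\<in>S. f x \<le> f z"
    using convex_on_above_tangent_plane[OF assms(1,2)] by (smt (verit, best))
qed

section \<open>Lagrange multipliers for linear functionals on conic slices\<close>

lemma orthogonal_to_kernel_imp_in_range_adjoint:
  fixes A :: "'a::euclidean_space \<Rightarrow> 'b::euclidean_space"
  assumes "linear A" and "\<And>d. A d = 0 \<Longrightarrow> w \<bullet> d = 0"
  obtains y where "w = adjoint A y"
proof -
  have sub: "subspace (range (adjoint A))"
    using assms(1) by (simp add: adjoint_linear linear_subspace_image)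
  have "w \<in> (A -` {0})\<^sup>\<bottom>"
    using assms(2) by (auto simp: orthogonal_comp_def orthogonal_def inner_commute)
  then have "w \<in> range (adjoint A)"
    using assms(1) sub by (simp add: ker_orthogonal_comp_adjoint orthogonal_comp_self)
  then show thesis
    using that by blast
qed

text \<open>
  From an interior point one can move a little in the direction \<open>-a\<close> and stay in the set, which
  would make the functional negative if it vanished at the point.
\<close>

lemma inner_pos_interior:
  fixes a :: "'a::real_inner"
  assumes "a \<noteq> 0" and "\<And>k. k \<in> K \<Longrightarrow> 0 \<le> a \<bullet> k" and "z \<in> interior K"
  shows "0 < a \<bullet> z"
proof -
  obtain \<epsilon> where "\<epsilon> > 0" and ball: "cball z \<epsilon> \<subseteq> K"
    using assms(3) mem_interior_cball by metis
  define t where "t = \<epsilon> / norm a"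
  have "t > 0"
    using \<open>\<epsilon> > 0\<close> assms(1) by (simp add: t_def)
  have "z - t *\<^sub>R a \<in> cball z \<epsilon>"
    using \<open>\<epsilon> > 0\<close> assms(1) by (simp add: t_def dist_norm)
  then have "0 \<le> a \<bullet> z - t * (a \<bullet> a)"
    using assms(2) ball by (fastforce simp: inner_diff_right)
  moreover have "0 < t * (a \<bullet> a)"
    using \<open>t > 0\<close> assms(1) by simp
  ultimately show ?thesis
    by linarith
qed

text \<open>
  A homogeneous Farkas argument: \<open>a\<close> is nonpositive also on the boundary of the
  half-space in \<open>V\<close>. That boundary is a subspace, so \<open>a\<close> vanishes on it, and one more direction
  \<open>d0\<close> determines \<open>a\<close> on \<open>V\<close>.
\<close>

lemma nonpos_on_open_halfspace_imp_multiple: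
  fixes a g :: "'a::real_inner"
  assumes "subspace V" and "d0 \<in> V" and "g \<bullet> d0 < 0"
    and neg: "\<And>d. d \<in> V \<Longrightarrow> g \<bullet> d < 0 \<Longrightarrow> a \<bullet> d \<le> 0"
  obtains c where "0 \<le> c" and "\<And>d. d \<in> V \<Longrightarrow> a \<bullet> d = c * (g \<bullet> d)"
proof -
  have half: "a \<bullet> d \<le> 0" if "d \<in> V" "g \<bullet> d = 0" for d
  proof (rule ccontr)
    assume "\<not> a \<bullet> d \<le> 0"
    then have "a \<bullet> d > 0"
      by simp
    \<comment> \<open>A large multiple of \<open>d\<close> outweighs \<open>d0\<close> under \<open>a\<close> without changing the value of \<open>g\<close>.\<close>
    define s where "s = (1 - a \<bullet> d0) / (a \<bullet> d)"
    have "a \<bullet> (d0 + s *\<^sub>R d) = 1"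
      using \<open>a \<bullet> d > 0\<close> by (simp add: s_def inner_add_right)
    moreover have "g \<bullet> (d0 + s *\<^sub>R d) < 0"
      using assms(3) that by (simp add: inner_add_right)
    moreover have "d0 + s *\<^sub>R d \<in> V"
      using assms(1,2) that by (simp add: subspace_add subspace_scale)
    ultimately show False
      using neg by fastforce
  qed
  define c where "c = (a \<bullet> d0) / (g \<bullet> d0)"
  have "0 \<le> c"
    using neg[OF assms(2,3)] assms(3) by (simp add: c_def divide_nonpos_neg)
  moreover have "a \<bullet> d = c * (g \<bullet> d)" if "d \<in> V" for d
  proof -
    define e where "e = d - ((g \<bullet> d) / (g \<bullet> d0)) *\<^sub>R d0"
    have "e \<in> V"
      using assms(1,2) that by (simp add: e_def subspace_diff subspace_scale)
    moreover have "g \<bullet> e = 0"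
      using assms(3) by (simp add: e_def inner_diff_right)
    ultimately have "a \<bullet> e \<le> 0" and "a \<bullet> (- e) \<le> 0"
      using half[of e] half[of "- e"] assms(1) by (simp_all add: subspace_neg)
    then have "a \<bullet> e = 0"
      by simp
    then show ?thesis
      by (simp add: e_def c_def inner_diff_right)
  qed
  ultimately show thesis
    using that by blast
qed

lemma nonneg_on_cone_of_bounded_below:
  fixes a :: "'a::real_inner"
  assumes "cone K" and bound: "\<And>k. k \<in> K \<Longrightarrow> \<beta> \<le> a \<bullet> k" and "k \<in> K"
  shows "0 \<le> a \<bullet> k"
proof (rule ccontr)
  assume "\<not> 0 \<le> a \<bullet> k"
  then have neg: "a \<bullet> k < 0"
    by simp
  define t where "t = (\<bar>\<beta>\<bar> + 1) / - (a \<bullet> k)"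
  have "0 \<le> t"
    using neg by (simp add: t_def divide_nonneg_neg)
  then have "\<beta> \<le> a \<bullet> (t *\<^sub>R k)"
    using assms(1,3) by (intro bound) (simp add: cone_def)
  moreover have "a \<bullet> (t *\<^sub>R k) = - (\<bar>\<beta>\<bar> + 1)"
    using neg by (simp add: t_def field_simps)
  ultimately show False
    by linarith
qed

text \<open>
  The multiplier is read off a hyperplane that separates \<open>K\<close> from the part of the slice on which
  the functional \<open>g\<close> is smaller than at \<open>x\<close>. Slater's condition keeps the coefficient of \<open>g\<close> in
  the normal of this hyperplane from vanishing.
\<close>

theorem conic_multiplier_exists:
  fixes A :: "'a::euclidean_space \<Rightarrow> 'b::euclidean_space"
  assumes "linear A" and "convex K" and "cone K" and "x \<in> K"
    and slater: "z0 \<in> interior K" "A z0 = A x"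
    and var: "\<And>z. z \<in> K \<Longrightarrow> A z = A x \<Longrightarrow> 0 \<le> g \<bullet> (z - x)"
  obtains y where "g - adjoint A y \<in> dual_cone K" and "x \<bullet> (g - adjoint A y) = 0"
proof (cases "\<exists>d. A d = 0 \<and> g \<bullet> d < 0")
  case False
  have "g \<bullet> d = 0" if "A d = 0" for d
  proof -
    have "A (- d) = 0"
      using that assms(1) by (simp add: linear_neg)
    with False that have "\<not> g \<bullet> d < 0" and "\<not> g \<bullet> (- d) < 0"
      by blast+
    then show ?thesis
      by simp
  qed
  then obtain y where "g = adjoint A y"
    using orthogonal_to_kernel_imp_in_range_adjoint[OF assms(1)] by blast
  then show ?thesis
    using that[of y] by (simp add: dual_cone_def)
next
  case True
  then obtain d0 where d0: "A d0 = 0" "g \<bullet> d0 < 0"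
    by blast
  define V where "V = {d. A d = 0}"
  have V: "subspace V"
    unfolding V_def by (rule linear_subspace_kernel[OF assms(1)])
  define D where "D = V \<inter> {d. g \<bullet> d < 0}"
  define L where "L = (+) x ` D"
  have "convex D"
    unfolding D_def using V by (intro convex_Int subspace_imp_convex convex_halfspace_lt)
  then have "convex L"
    unfolding L_def by (rule convex_translation)
  moreover have "L \<noteq> {}"
    using d0 by (auto simp: L_def D_def V_def)
  moreover have "L \<inter> K = {}"
  proof -
    have False if "d \<in> D" "x + d \<in> K" for d
      using var[of "x + d"] that assms(1) by (simp add: D_def V_def linear_add)
    then show ?thesis
      by (auto simp: L_def)
  qed
  ultimately obtain a \<beta> where "a \<noteq> 0"
    and L: "\<And>l. l \<in> L \<Longrightarrow> a \<bullet> l \<le> \<beta>" and K: "\<And>k. k \<in> K \<Longrightarrow> \<beta> \<le> a \<bullet> k"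
    using separating_hyperplane_sets[of L K] assms(2,4) by blast
  have nonneg: "0 \<le> a \<bullet> k" if "k \<in> K" for k
    using nonneg_on_cone_of_bounded_below[OF assms(3) K that] .
  have "0 \<in> K"
    using assms(3,4) cone_contains_0 by blast
  then have "\<beta> \<le> 0"
    using K by fastforce
  \<comment> \<open>The case \<open>t = 1\<close> gives the sign of \<open>a\<close> on \<open>D\<close>; the limit \<open>t \<rightarrow> 0\<close> gives \<open>a \<bullet> x \<le> 0\<close>.\<close>
  have ray: "a \<bullet> x + t * (a \<bullet> d) \<le> 0" if "d \<in> D" "t > 0" for d t
  proof -
    have "t *\<^sub>R d \<in> D"
      using that V by (simp add: D_def subspace_scale mult_pos_neg)
    then have "a \<bullet> (x + t *\<^sub>R d) \<le> \<beta>"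
      by (intro L) (simp add: L_def)
    with \<open>\<beta> \<le> 0\<close> show ?thesis
      by (simp add: inner_add_right)
  qed
  have D_nonpos: "a \<bullet> d \<le> 0" if "d \<in> D" for d
    using ray[OF that, of 1] nonneg[OF assms(4)] by simp
  have "((\<lambda>t. a \<bullet> x + t * (a \<bullet> d0)) \<longlongrightarrow> a \<bullet> x + 0 * (a \<bullet> d0)) (at_right 0)"
    by (intro tendsto_intros)
  then have "a \<bullet> x + 0 * (a \<bullet> d0) \<le> 0"
    by (rule tendsto_upperbound)
      (use ray[of d0] d0 in \<open>auto simp: D_def V_def
        intro!: eventually_mono[OF eventually_at_right_less]\<close>)
  with nonneg[OF assms(4)] have x0: "a \<bullet> x = 0"
    by simp
  obtain c where "0 \<le> c" and c: "\<And>d. d \<in> V \<Longrightarrow> a \<bullet> d = c * (g \<bullet> d)"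
    by (rule nonpos_on_open_halfspace_imp_multiple[OF V, of d0 g a])
      (use d0 D_nonpos in \<open>auto simp: D_def V_def\<close>)
  have "c \<noteq> 0"
  proof
    assume "c = 0"
    have "z0 - x \<in> V"
      using assms(1) slater(2) by (simp add: V_def linear_diff)
    then have "a \<bullet> z0 = 0"
      using c \<open>c = 0\<close> x0 by (fastforce simp: inner_diff_right)
    moreover have "0 < a \<bullet> z0"
      using inner_pos_interior[OF \<open>a \<noteq> 0\<close> nonneg slater(1)] .
    ultimately show False
      by simp
  qed
  have "(g - a /\<^sub>R c) \<bullet> d = 0" if "A d = 0" for d
    using c[of d] that \<open>c \<noteq> 0\<close> by (simp add: V_def inner_diff_left)
  then obtain y where "g - a /\<^sub>R c = adjoint A y"
    using orthogonal_to_kernel_imp_in_range_adjoint[OF assms(1)] by blast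
  then have y: "g - adjoint A y = a /\<^sub>R c"
    by (simp add: algebra_simps)
  show ?thesis
  proof (rule that)
    show "g - adjoint A y \<in> dual_cone K"
      using nonneg \<open>0 \<le> c\<close> by (simp add: y dual_cone_def inner_commute[of _ a])
    show "x \<bullet> (g - adjoint A y) = 0"
      using x0 by (simp add: y inner_commute[of x])
  qed
qed

theorem multiplier_imp_variational:
  fixes A :: "'a::euclidean_space \<Rightarrow> 'b::euclidean_space"
  assumes "linear A" and "g - adjoint A y \<in> dual_cone K" and "x \<bullet> (g - adjoint A y) = 0"
    and "z \<in> K" and "A z = A x"
  shows "0 \<le> g \<bullet> (z - x)"
proof -
  have "0 \<le> (z - x) \<bullet> (g - adjoint A y)"
    using assms(2-4) by (simp add: dual_cone_def inner_diff_left)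
  also have "\<dots> = (z - x) \<bullet> g - A (z - x) \<bullet> y"
    using assms(1) by (simp add: inner_diff_right adjoint_works)
  also have "\<dots> = g \<bullet> (z - x)"
    using assms(1,5) by (simp add: linear_diff inner_commute)
  finally show ?thesis .
qed

section \<open>Conic optimization as a complementarity problem\<close>

theorem theorem2:
  fixes f :: "real^'q \<Rightarrow> real"
    and A :: "real^'q^'p"
    and b :: "real^'p"
    and K :: "(real^'q) set"
    and xhat :: "real^'q"
  assumes "xhat \<noteq> 0"
    and "convex_on UNIV f"
    and "f differentiable (at xhat)"
    and "closed_convex_cone K"
    and "smooth_boundary_off_origin K"
    and "rank A = min CARD('p) CARD('q)"
    and "interior K \<inter> {x. A *v x = b} \<noteq> {}"
  shows "(CO_solution f A b K xhat \<longleftrightarrow>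
           (\<exists>yhat. MiCP_solution (\<lambda>y x. b - A *v x) (\<lambda>y x. gradient f x - transpose A *v y)
                     K (yhat, xhat))) \<and>
         (CO_solution f A b K xhat \<longleftrightarrow>
           (\<exists>yhat. A *v xhat = b \<and> xhat \<in> K \<and>
              gradient f xhat - transpose A *v yhat \<in> dual_cone K \<and>
              xhat \<bullet> (gradient f xhat - transpose A *v yhat) = 0))"
proof -
  define g where "g = gradient f xhat"
  have g: "GDERIV f xhat :> g"
    unfolding g_def by (rule gderiv_gradient[OF assms(3)])
  have K: "convex K" "cone K"
    using assms(4) by (auto simp: closed_convex_cone_iff_cone)
  have lin: "linear ((*v) A)"
    by simp
  have adj: "adjoint ((*v) A) = (*v) (transpose A)"
    by (rule adjoint_matrix)
  obtain z0 where z0: "z0 \<in> interior K" "A *v z0 = b"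
    using assms(7) by blast
  define S where "S = K \<inter> {z. A *v z = b}"
  have "convex S"
    unfolding S_def using K(1) by (auto simp: convex_def matrix_vector_right_distrib
        matrix_vector_mult_scaleR simp flip: scaleR_left_distrib)
  let ?KKT = "\<lambda>y. A *v xhat = b \<and> xhat \<in> K \<and> g - transpose A *v y \<in> dual_cone K \<and>
    xhat \<bullet> (g - transpose A *v y) = 0"
  have "CO_solution f A b K xhat \<longleftrightarrow> xhat \<in> S \<and> (\<forall>z\<in>S. f xhat \<le> f z)"
    by (auto simp: CO_solution_def S_def)
  also have "\<dots> \<longleftrightarrow> xhat \<in> S \<and> (\<forall>z\<in>S. 0 \<le> g \<bullet> (z - xhat))"
    using convex_minimizer_iff_variational[OF assms(2) g \<open>convex S\<close>] by blast
  also have "\<dots> \<longleftrightarrow> (\<exists>y. ?KKT y)"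
  proof
    assume var: "xhat \<in> S \<and> (\<forall>z\<in>S. 0 \<le> g \<bullet> (z - xhat))"
    then have feasible: "xhat \<in> K" "A *v xhat = b"
      by (auto simp: S_def)
    obtain y where "g - adjoint ((*v) A) y \<in> dual_cone K" "xhat \<bullet> (g - adjoint ((*v) A) y) = 0"
      by (rule conic_multiplier_exists[OF lin K feasible(1) z0(1), of g])
        (use var z0(2) feasible in \<open>auto simp: S_def\<close>)
    then show "\<exists>y. ?KKT y"
      using feasible by (auto simp: adj)
  next
    assume "\<exists>y. ?KKT y"
    then obtain y where y: "?KKT y" ..
    have "0 \<le> g \<bullet> (z - xhat)" if "z \<in> S" for z
      by (rule multiplier_imp_variational[OF lin, of g y K])
        (use y that in \<open>auto simp: S_def adj\<close>)
    then show "xhat \<in> S \<and> (\<forall>z\<in>S. 0 \<le> g \<bullet> (z - xhat))"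
      using y by (simp add: S_def)
  qed
  finally have KKT: "CO_solution f A b K xhat \<longleftrightarrow> (\<exists>y. ?KKT y)" .
  have "MiCP_solution (\<lambda>y x. b - A *v x) (\<lambda>y x. gradient f x - transpose A *v y) K (y, xhat)
      \<longleftrightarrow> ?KKT y" for y
    by (auto simp: MiCP_solution_def orthogonal_def g_def)
  with KKT show ?thesis
    by (simp add: g_def)
qed

end
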